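(* Let $n,m\ge 1$ and $1\le k\le n$ be integers and $L\ge 0$. Let utilities be the mean review scores $u_i(X)=\frac1m\sum_{j=1}^m X_{i,j}$ for $X\in[0,1]^{n\times m}$, and consider any $L$-smooth randomized selection rule for selecting $k$ of $n$ candidates. Then its worst-case regret satisfies $$\max_{X\in[0,1]^{n\times m}}\mathrm{Regret}(X)\;\ge\;\begin{cases}\dfrac{k\left(1-\frac kn\right)^2}{2\,m\,L}, & \text{if } L\ge\frac1m\left(1-\frac kn\right),\\[1em] k\left(1-\frac kn-\frac{L\,m}{2}\right), & \text{if } L<\frac1m\left(1-\frac kn\right).\end{cases}$$
   Context: A randomized selection rule maps each review matrix $X\in[0,1]^{n\times m}$ to a probability distribution on the size-$k$ subsets of $[n]=\{1,\dots,n\}$. Its marginal selection probabilities are $p_i(X)=\Pr_S[i\in S]$, where $S$ is drawn from that distribution. The rule is $L$-smooth if $\|p(X)-p(X')\|_1\le L\|X-X'\|_{1,1}$ for all $X,X'\in[0,1]^{n\times m}$, where $\|A\|_{1,1}=\sum_{i,j}|A_{i,j}|$. Regret: $\mathrm{Regret}(X)=\mathrm{OPT}(X)-p(X)^\top u(X)$, where $\mathrm{OPT}(X)$ is the sum of the $k$ largest entries of $u(X)$. In the degenerate case $k=n$, $L=0$, the bound $0/0$ is read as $0$. *)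

theory Defs
  imports "HOL-Probability.Probability"
begin

(* The index types 'n (candidates) and 'm (reviewers per candidate) are arbitrary finite
   nonempty types; the paper's n and m are CARD('n) and CARD('m). *)

definition review_matrices :: "(real ^ 'm ^ 'n) set" where
  "review_matrices = {X. \<forall>i j. 0 \<le> X $ i $ j \<and> X $ i $ j \<le> 1}"

(* Only the values of a rule on review_matrices matter; outside that set the total function is
   unconstrained. *)
definition selection_rule :: "nat \<Rightarrow> (real ^ 'm ^ 'n \<Rightarrow> 'n set pmf) \<Rightarrow> bool" where
  "selection_rule k R \<longleftrightarrow> (\<forall>X \<in> review_matrices. set_pmf (R X) \<subseteq> {S. card S = k})"

definition marginals :: "(real ^ 'm ^ 'n \<Rightarrow> 'n set pmf) \<Rightarrow> real ^ 'm ^ 'n \<Rightarrow> real ^ 'n" where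
  "marginals R X = (\<chi> i. measure_pmf.prob (R X) {S. i \<in> S})"

definition vec_norm1 :: "real ^ 'n \<Rightarrow> real" where
  "vec_norm1 v = (\<Sum>i\<in>UNIV. \<bar>v $ i\<bar>)"

definition mat_norm11 :: "real ^ 'm ^ 'n \<Rightarrow> real" where
  "mat_norm11 A = (\<Sum>i\<in>UNIV. \<Sum>j\<in>UNIV. \<bar>A $ i $ j\<bar>)"

definition smooth_rule :: "real \<Rightarrow> (real ^ 'm ^ 'n \<Rightarrow> 'n set pmf) \<Rightarrow> bool" where
  "smooth_rule L R \<longleftrightarrow>
     (\<forall>X \<in> review_matrices. \<forall>X' \<in> review_matrices.
        vec_norm1 (marginals R X - marginals R X') \<le> L * mat_norm11 (X - X'))"

definition mean_utility :: "real ^ 'm ^ 'n \<Rightarrow> real ^ 'n" where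
  "mean_utility X = (\<chi> i. (1 / real CARD('m)) * (\<Sum>j\<in>UNIV. X $ i $ j))"

(* Entries are listed with multiplicity, so ties are counted correctly. *)
definition sum_k_largest :: "nat \<Rightarrow> real ^ 'n \<Rightarrow> real" where
  "sum_k_largest k v =
     sum_list (take k (rev (sorted_list_of_multiset (image_mset (($) v) (mset_set UNIV)))))"

definition regret :: "nat \<Rightarrow> (real ^ 'm ^ 'n \<Rightarrow> 'n set pmf) \<Rightarrow> real ^ 'm ^ 'n \<Rightarrow> real" where
  "regret k R X =
     sum_k_largest k (mean_utility X) - marginals R X \<bullet> mean_utility X"

end

theory Submission
  imports Defs
begin

text \<open>
  On the zero matrix the marginals sum to \<open>k\<close>, so the \<open>k\<close> candidates with the smallest
  marginals have total marginal at most \<open>k\<^sup>2 / n\<close>. Raise all scores of these candidates to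
  \<open>\<delta>\<close>. As the marginals always sum to \<open>k\<close>, mass gained by the raised candidates is lost by
  the others, so smoothness allows a gain of only half the \<open>\<ell>\<^sub>1\<close> budget, \<open>L k m \<delta> / 2\<close>. The
  regret is then at least \<open>k \<delta> (1 - k / n - L m \<delta> / 2)\<close>, and one optimises over \<open>\<delta> \<in> [0, 1]\<close>.
  The maximum is attained because the regret is continuous on a compact set.
\<close>

section \<open>Sums of the \<open>k\<close> largest entries\<close>

text \<open>With the indices listed by decreasing value, \<open>S\<close> consists of the first
  \<open>k\<close> and \<open>t\<close> is the \<open>k\<close>-th largest value. Later arguments
  use only such pairs and never return to sorted lists.\<close>

lemma sum_k_largest_threshold:
  fixes v :: "real ^ 'n::finite"
  assumes "1 \<le> k" and "k \<le> CARD('n)"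
  obtains S t where "card S = k" and "\<And>i. i \<in> S \<Longrightarrow> t \<le> v $ i" and "\<And>i. i \<notin> S \<Longrightarrow> v $ i \<le> t"
    and "sum_k_largest k v = (\<Sum>i\<in>S. v $ i)"
proof -
  obtain l :: "'n list" where l: "set l = UNIV" "distinct l"
    using finite_distinct_list[of "UNIV :: 'n set"] by auto
  define xs where "xs = rev (sort_key (($) v) l)"
  have xs: "set xs = UNIV" "distinct xs"
    using l by (auto simp: xs_def)
  have len: "length xs = CARD('n)"
    using xs distinct_card by fastforce
  have "mset_set UNIV = mset l"
    using l mset_set_set by metis
  \<comment> \<open>A sorted list is determined by its multiset, so sorting values agrees with
    sorting indices by value, even with ties.\<close>
  moreover have "sort (map (($) v) l) = map (($) v) (sort_key (($) v) l)"
    by (rule properties_for_sort) simp_all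
  ultimately have "rev (sorted_list_of_multiset (image_mset (($) v) (mset_set UNIV))) = map (($) v) xs"
    by (simp add: xs_def rev_map flip: mset_map)
  then have sum_eq: "sum_k_largest k v = (\<Sum>i\<in>set (take k xs). v $ i)"
    using xs by (simp add: sum_k_largest_def take_map sum_list_distinct_conv_sum_set)
  have desc: "v $ (xs ! j) \<le> v $ (xs ! i)" if "i \<le> j" "j < CARD('n)" for i j
  proof -
    have "sorted (rev (map (($) v) xs))"
      by (simp add: xs_def rev_map)
    then have "map (($) v) xs ! j \<le> map (($) v) xs ! i"
      using that len by (intro sorted_rev_nth_mono) auto
    then show ?thesis
      using that len by simp
  qed
  show thesis
  \<comment> \<open>Lists count from 0, so the \<open>k\<close>-th largest value sits at
    \<open>k - 1\<close>.\<close>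
  proof (rule that[of "set (take k xs)" "v $ (xs ! (k - 1))"])
    show "card (set (take k xs)) = k"
      using assms xs len by (simp add: distinct_card)
    show "v $ (xs ! (k - 1)) \<le> v $ i" if "i \<in> set (take k xs)" for i
      using that assms len by (auto simp: in_set_conv_nth intro!: desc)
    show "v $ i \<le> v $ (xs ! (k - 1))" if "i \<notin> set (take k xs)" for i
    proof -
      obtain j where j: "j < CARD('n)" "i = xs ! j"
        using xs len by (metis UNIV_I in_set_conv_nth)
      have "k \<le> j"
      proof (rule ccontr)
        assume "\<not> k \<le> j"
        then have "take k xs ! j \<in> set (take k xs)"
          using j len by (intro nth_mem) simp
        with \<open>\<not> k \<le> j\<close> j that show False
          by simp
      qed
      then show ?thesis
        using j by (auto intro: desc)
    qed
  qed (rule sum_eq)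
qed

text \<open>Exchange argument: \<open>T - S\<close> and \<open>S - T\<close> have equal size, and
  the threshold \<open>t\<close> separates the entries on the two sides.\<close>

lemma sum_le_sum_k_largest:
  fixes v :: "real ^ 'n::finite"
  assumes "1 \<le> k" and T: "card T = k"
  shows "(\<Sum>i\<in>T. v $ i) \<le> sum_k_largest k v"
proof -
  have "k \<le> CARD('n)"
    using T by (metis card_mono finite_class.finite_UNIV subset_UNIV)
  from sum_k_largest_threshold[OF \<open>1 \<le> k\<close> this, of v]
  obtain S t where S: "card S = k" "\<And>i. i \<in> S \<Longrightarrow> t \<le> v $ i"
      "\<And>i. i \<notin> S \<Longrightarrow> v $ i \<le> t" "sum_k_largest k v = (\<Sum>i\<in>S. v $ i)"
    by blast
  have "card (T - S) = card (S - T)"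
    using S(1) T by (simp add: card_le_sym_Diff card_Diff_subset_Int Int_commute)
  moreover have "(\<Sum>i\<in>T - S. v $ i) \<le> of_nat (card (T - S)) * t"
    by (rule sum_bounded_above) (auto intro: S)
  moreover have "of_nat (card (S - T)) * t \<le> (\<Sum>i\<in>S - T. v $ i)"
    by (rule sum_bounded_below) (auto intro: S)
  moreover have "(\<Sum>i\<in>T. v $ i) = (\<Sum>i\<in>T - S. v $ i) + (\<Sum>i\<in>S \<inter> T. v $ i)"
    "(\<Sum>i\<in>S. v $ i) = (\<Sum>i\<in>S - T. v $ i) + (\<Sum>i\<in>S \<inter> T. v $ i)"
    by (simp_all add: sum.Int_Diff[of T _ S] sum.Int_Diff[of S _ T] Int_commute)
  ultimately show ?thesis
    using S(4) by simp
qed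

text \<open>A maximum of finitely many linear functions of \<open>v\<close> is visibly continuous,
  unlike the form with sorted lists.\<close>

lemma sum_k_largest_eq_Max:
  fixes v :: "real ^ 'n::finite"
  assumes "1 \<le> k" and "k \<le> CARD('n)"
  shows "sum_k_largest k v = Max ((\<lambda>S. \<Sum>i\<in>S. v $ i) ` {S. card S = k})"
proof -
  obtain S where S: "card S = k" "sum_k_largest k v = (\<Sum>i\<in>S. v $ i)"
    using sum_k_largest_threshold[OF assms] by metis
  show ?thesis
  proof (rule Max_eqI[symmetric])
    show "sum_k_largest k v \<in> (\<lambda>S. \<Sum>i\<in>S. v $ i) ` {S. card S = k}"
      using S by blast
  qed (use sum_le_sum_k_largest[OF assms(1)] in auto)
qed

lemma continuous_on_Max_image:
  fixes f :: "'b \<Rightarrow> 'a::topological_space \<Rightarrow> 'c::linorder_topology"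
  assumes "finite A" and "A \<noteq> {}" and "\<And>a. a \<in> A \<Longrightarrow> continuous_on U (f a)"
  shows "continuous_on U (\<lambda>x. Max ((\<lambda>a. f a x) ` A))"
  using assms
proof (induction A rule: finite_ne_induct)
  case (insert a A)
  then have "(\<lambda>x. Max ((\<lambda>a. f a x) ` insert a A)) = (\<lambda>x. max (f a x) (Max ((\<lambda>a. f a x) ` A)))"
    by auto
  then show ?case
    using insert by (auto intro!: continuous_on_max)
qed auto

lemma continuous_on_sum_k_largest:
  assumes "1 \<le> k" and "k \<le> CARD('n::finite)"
  shows "continuous_on U (sum_k_largest k :: real ^ 'n \<Rightarrow> real)"
proof -
  have "{S :: 'n set. card S = k} \<noteq> {}"
    using obtain_subset_with_card_n[OF assms(2)] by blast
  then have "continuous_on U (\<lambda>v :: real ^ 'n. Max ((\<lambda>S. \<Sum>i\<in>S. v $ i) ` {S. card S = k}))"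
    by (intro continuous_on_Max_image) (auto intro!: continuous_intros)
  then show ?thesis
    by (simp add: sum_k_largest_eq_Max[OF assms] cong: continuous_on_cong)
qed

text \<open>The average of the \<open>k\<close> smallest entries cannot exceed the overall
  average.\<close>

lemma exists_small_sum_subset:
  fixes w :: "real ^ 'n::finite"
  assumes "1 \<le> k" and "k \<le> CARD('n)"
  obtains S where "card S = k"
    and "real CARD('n) * (\<Sum>i\<in>S. w $ i) \<le> real k * (\<Sum>i\<in>UNIV. w $ i)"
proof -
  \<comment> \<open>The smallest entries of \<open>w\<close> are the largest of \<open>- w\<close>,
    so \<open>- t\<close> is the threshold for \<open>w\<close>.\<close>
  obtain S t where S: "card S = k" "\<And>i. i \<in> S \<Longrightarrow> t \<le> (- w) $ i"
      "\<And>i. i \<notin> S \<Longrightarrow> (- w) $ i \<le> t"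
    using sum_k_largest_threshold[OF assms] by metis
  have "(\<Sum>i\<in>S. w $ i) \<le> of_nat (card S) * (- t)"
    by (rule sum_bounded_above) (use S(2) in force)
  moreover have "of_nat (card (- S)) * (- t) \<le> (\<Sum>i\<in>- S. w $ i)"
    by (rule sum_bounded_below) (use S(3) in force)
  moreover have "real (card (- S)) = real CARD('n) - real k"
    using S(1) assms by (simp add: Compl_eq_Diff_UNIV card_Diff_subset)
  ultimately have le: "(\<Sum>i\<in>S. w $ i) \<le> real k * (- t)"
      "(real CARD('n) - real k) * (- t) \<le> (\<Sum>i\<in>- S. w $ i)"
    using S(1) by simp_all
  \<comment> \<open>Multiplying by \<open>CARD('n) - k\<close>, rather than dividing by it, also
    covers \<open>k = CARD('n)\<close>.\<close>
  have "(real CARD('n) - real k) * (\<Sum>i\<in>S. w $ i) \<le> (real CARD('n) - real k) * (real k * (- t))"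
    using le(1) assms by (intro mult_left_mono) auto
  also have "\<dots> = real k * ((real CARD('n) - real k) * (- t))"
    by simp
  also have "\<dots> \<le> real k * (\<Sum>i\<in>- S. w $ i)"
    using le(2) by (intro mult_left_mono) auto
  finally have "real CARD('n) * (\<Sum>i\<in>S. w $ i) \<le> real k * ((\<Sum>i\<in>S. w $ i) + (\<Sum>i\<in>- S. w $ i))"
    by (simp add: algebra_simps)
  also have "(\<Sum>i\<in>S. w $ i) + (\<Sum>i\<in>- S. w $ i) = (\<Sum>i\<in>UNIV. w $ i)"
    by (simp add: Compl_eq_Diff_UNIV sum.subset_diff[of S UNIV])
  finally show thesis
    using that S(1) by blast
qed

section \<open>Marginals and existence of a worst-case matrix\<close>

text \<open>By linearity of expectation: the membership indicators add up to \<open>card S\<close>,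
  which is \<open>k\<close> almost surely.\<close>

lemma sum_marginals:
  assumes "selection_rule k R" and "X \<in> review_matrices"
  shows "(\<Sum>i\<in>UNIV. marginals R X $ i) = real k"
proof -
  have "(\<Sum>i\<in>UNIV. marginals R X $ i) =
      (\<Sum>i\<in>UNIV. measure_pmf.expectation (R X) (indicator {S. i \<in> S}))"
    by (simp add: marginals_def)
  also have "\<dots> = measure_pmf.expectation (R X) (\<lambda>S. \<Sum>i\<in>UNIV. indicator {S. i \<in> S} S)"
    by (intro Bochner_Integration.integral_sum[symmetric] integrable_measure_pmf_finite) simp
  also have "\<dots> = measure_pmf.expectation (R X) (\<lambda>S. real (card S))"
    by (simp add: indicator_def flip: sum.inter_filter)
  also have "\<dots> = measure_pmf.expectation (R X) (\<lambda>S. real k)"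
    using assms by (intro integral_cong_AE) (auto simp: AE_measure_pmf_iff selection_rule_def)
  finally show ?thesis
    by simp
qed

lemma compact_review_matrices:
  "compact (review_matrices :: (real ^ 'm::finite ^ 'n::finite) set)"
proof -
  have "review_matrices = {(\<chi> i. \<chi> j. 0) .. (\<chi> i. \<chi> j. 1) :: real ^ 'm ^ 'n}"
    by (auto simp: review_matrices_def less_eq_vec_def)
  then show ?thesis
    by (metis compact_cbox interval_cbox)
qed

text \<open>Smoothness is a Lipschitz bound in \<ell>1 norms. It transfers to the Euclidean topology
  because the \<ell>1 norm dominates the Euclidean one and \<open>mat_norm11 (Y - X)\<close> tends
  to 0 as \<open>Y\<close> tends to \<open>X\<close>.\<close>

lemma continuous_on_marginals:
  fixes R :: "real ^ 'm::finite ^ 'n::finite \<Rightarrow> 'n set pmf"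
  assumes "smooth_rule L R"
  shows "continuous_on review_matrices (marginals R)"
  unfolding continuous_on_def
proof
  fix X :: "real ^ 'm ^ 'n"
  assume X: "X \<in> review_matrices"
  have "((\<lambda>Y. L * mat_norm11 (Y - X)) \<longlongrightarrow> L * mat_norm11 (X - X)) (at X within review_matrices)"
    unfolding mat_norm11_def by (intro tendsto_intros)
  then have lim: "((\<lambda>Y. L * mat_norm11 (Y - X)) \<longlongrightarrow> 0) (at X within review_matrices)"
    by (simp add: mat_norm11_def)
  have "norm (marginals R Y - marginals R X) \<le> L * mat_norm11 (Y - X)"
    if "Y \<in> review_matrices" for Y
  proof -
    have "norm (marginals R Y - marginals R X) \<le> vec_norm1 (marginals R Y - marginals R X)"
      unfolding vec_norm1_def by (rule norm_le_l1_cart)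
    also have "\<dots> \<le> L * mat_norm11 (Y - X)"
      using assms X that by (auto simp: smooth_rule_def)
    finally show ?thesis .
  qed
  then have "\<forall>\<^sub>F Y in at X within review_matrices.
      norm (marginals R Y - marginals R X) \<le> L * mat_norm11 (Y - X)"
    by (auto simp: eventually_at_filter)
  then have "((\<lambda>Y. marginals R Y - marginals R X) \<longlongrightarrow> 0) (at X within review_matrices)"
    using lim by (rule Lim_null_comparison)
  then show "(marginals R \<longlongrightarrow> marginals R X) (at X within review_matrices)"
    by (simp add: Lim_null[symmetric])
qed

lemma regret_attains_max:
  fixes R :: "real ^ 'm::finite ^ 'n::finite \<Rightarrow> 'n set pmf"
  assumes "1 \<le> k" and "k \<le> CARD('n)" and "smooth_rule L R"
  obtains X where "X \<in> review_matrices"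
    and "\<And>Y. Y \<in> review_matrices \<Longrightarrow> regret k R Y \<le> regret k R X"
proof -
  have u: "continuous_on review_matrices (mean_utility :: real ^ 'm ^ 'n \<Rightarrow> _)"
    unfolding mean_utility_def by (intro continuous_intros)
  have "continuous_on review_matrices (regret k R)"
    unfolding regret_def
    by (intro continuous_on_diff continuous_on_inner continuous_on_marginals[OF assms(3)] u
        continuous_on_compose2[OF continuous_on_sum_k_largest[OF assms(1,2), of UNIV] u]) simp
  moreover have "0 \<in> (review_matrices :: (real ^ 'm ^ 'n) set)"
    by (simp add: review_matrices_def)
  ultimately show thesis
    using continuous_attains_sup[OF compact_review_matrices] that by (metis empty_iff)
qed

section \<open>The lower bound\<close>

text \<open>The sums over \<open>S\<close> and \<open>- S\<close> are opposite, so each of the two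
  sets contributes at least the sum over \<open>S\<close> to the norm.\<close>

lemma two_sum_le_vec_norm1:
  fixes d :: "real ^ 'n::finite"
  assumes "(\<Sum>i\<in>UNIV. d $ i) = 0"
  shows "2 * (\<Sum>i\<in>S. d $ i) \<le> vec_norm1 d"
proof -
  have split: "sum f UNIV = sum f S + sum f (- S)" for f :: "'n \<Rightarrow> real"
    by (simp add: Compl_eq_Diff_UNIV sum.subset_diff[of S UNIV])
  have "(\<Sum>i\<in>S. d $ i) \<le> (\<Sum>i\<in>S. \<bar>d $ i\<bar>)"
    by (rule sum_mono) simp
  moreover have "(\<Sum>i\<in>- S. - (d $ i)) \<le> (\<Sum>i\<in>- S. \<bar>d $ i\<bar>)"
    by (rule sum_mono) simp
  ultimately show ?thesis
    using assms split[of "($) d"] split[of "\<lambda>i. \<bar>d $ i\<bar>"]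
    by (simp add: vec_norm1_def sum_negf)
qed

text \<open>Keeping \<delta> free gives one family of bounds from which both cases of the final
  bound follow.\<close>

lemma exists_large_regret:
  fixes R :: "real ^ 'm::finite ^ 'n::finite \<Rightarrow> 'n set pmf"
  assumes k: "1 \<le> k" "k \<le> CARD('n)" and rule: "selection_rule k R" and smooth: "smooth_rule L R"
    and \<delta>: "0 \<le> \<delta>" "\<delta> \<le> 1"
  shows "\<exists>X\<in>review_matrices.
    real k * \<delta> * (1 - real k / real CARD('n) - L * real CARD('m) * \<delta> / 2) \<le> regret k R X"
proof -
  have zero: "0 \<in> (review_matrices :: (real ^ 'm ^ 'n) set)"
    by (simp add: review_matrices_def)
  obtain S where S: "card S = k"
    "real CARD('n) * (\<Sum>i\<in>S. marginals R 0 $ i) \<le> real k * (\<Sum>i\<in>UNIV. marginals R 0 $ i)"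
    using exists_small_sum_subset[OF k] .
  define X :: "real ^ 'm ^ 'n" where "X = (\<chi> i. \<chi> j. if i \<in> S then \<delta> else 0)"
  have X: "X \<in> review_matrices"
    using \<delta> by (simp add: review_matrices_def X_def)
  have u: "mean_utility X $ i = (if i \<in> S then \<delta> else 0)" for i
    by (simp add: mean_utility_def X_def)
  have "(\<Sum>i\<in>S. marginals R 0 $ i) \<le> real k * (real k / real CARD('n))"
    using S(2) sum_marginals[OF rule zero] by (simp add: field_simps)
  moreover have "2 * (\<Sum>i\<in>S. (marginals R X - marginals R 0) $ i)
      \<le> vec_norm1 (marginals R X - marginals R 0)"
    using sum_marginals[OF rule X] sum_marginals[OF rule zero]
    by (intro two_sum_le_vec_norm1) (simp add: sum_subtractf)
  moreover have "mat_norm11 (X - 0) = (\<Sum>i\<in>UNIV. if i \<in> S then real CARD('m) * \<delta> else 0)"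
    unfolding mat_norm11_def using \<delta> by (intro sum.cong) (auto simp: X_def)
  then have "mat_norm11 (X - 0) = real k * (real CARD('m) * \<delta>)"
    using S(1) by (simp flip: sum.inter_filter)
  moreover have "vec_norm1 (marginals R X - marginals R 0) \<le> L * mat_norm11 (X - 0)"
    using smooth X zero unfolding smooth_rule_def by blast
  \<comment> \<open>The first summand bounds the mass of \<open>S\<close> at the zero matrix, the
    second is half the smoothness budget.\<close>
  ultimately have "(\<Sum>i\<in>S. marginals R X $ i) \<le>
      real k * (real k / real CARD('n)) + L * (real k * (real CARD('m) * \<delta>)) / 2"
    by (simp add: sum_subtractf)
  then have "real k * (1 - real k / real CARD('n) - L * real CARD('m) * \<delta> / 2)
      \<le> real k - (\<Sum>i\<in>S. marginals R X $ i)"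
    by (simp add: algebra_simps)
  then have "\<delta> * (real k * (1 - real k / real CARD('n) - L * real CARD('m) * \<delta> / 2))
      \<le> \<delta> * (real k - (\<Sum>i\<in>S. marginals R X $ i))"
    using \<delta>(1) by (rule mult_left_mono)
  moreover have "real k * \<delta> \<le> sum_k_largest k (mean_utility X)"
    using sum_le_sum_k_largest[OF k(1) S(1), of "mean_utility X"] S(1) by (simp add: u)
  moreover have "marginals R X \<bullet> mean_utility X = \<delta> * (\<Sum>i\<in>S. marginals R X $ i)"
    by (simp add: inner_vec_def u sum_distrib_left if_distrib mult.commute
        flip: sum.inter_filter cong: if_cong)
  ultimately have "real k * \<delta> * (1 - real k / real CARD('n) - L * real CARD('m) * \<delta> / 2)
      \<le> regret k R X"
    by (simp add: regret_def algebra_simps)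
  with X show ?thesis
    by blast
qed

theorem theorem3:
  fixes R :: "real ^ 'm::finite ^ 'n::finite \<Rightarrow> 'n set pmf"
    and k :: nat and L :: real
  assumes "1 \<le> k" and "k \<le> CARD('n)" and "0 \<le> L"
    and "selection_rule k R"
    and "smooth_rule L R"
  shows "\<exists>X. is_arg_max (regret k R) (\<lambda>X. X \<in> review_matrices) X \<and>
    regret k R X \<ge>
      (if L \<ge> (1 / real CARD('m)) * (1 - real k / real CARD('n))
       then real k * (1 - real k / real CARD('n))\<^sup>2 / (2 * real CARD('m) * L)
       else real k * (1 - real k / real CARD('n) - L * real CARD('m) / 2))"
proof -
  define a where "a = 1 - real k / real CARD('n)"
  define m where "m = real CARD('m)"
  have a: "0 \<le> a"
    using assms(2) by (simp add: a_def)
  have m: "0 < m"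
    by (simp add: m_def)
  obtain X where X: "X \<in> review_matrices"
    and max: "\<And>Y. Y \<in> review_matrices \<Longrightarrow> regret k R Y \<le> regret k R X"
    using regret_attains_max[OF assms(1,2,5)] by blast
  have ge: "real k * \<delta> * (a - L * m * \<delta> / 2) \<le> regret k R X" if "0 \<le> \<delta>" "\<delta> \<le> 1" for \<delta>
    using exists_large_regret[OF assms(1,2,4,5) that] max unfolding a_def m_def
    by (meson order_trans)
  have "(if L \<ge> (1 / m) * a then real k * a\<^sup>2 / (2 * m * L) else real k * (a - L * m / 2))
      \<le> regret k R X"
  \<comment> \<open>As a function of \<delta>,
    \<open>real k * \<delta> * (a - L * m * \<delta> / 2)\<close> has its vertex at
    \<open>a / (L * m)\<close> if \<open>L > 0\<close>. In the first case the vertex lies in the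
    unit interval; in the second the function increases up to 1, so \<open>\<delta> = 1\<close> is
    best.\<close>
  proof (cases "L \<ge> (1 / m) * a")
    case True
    \<comment> \<open>For \<open>L = 0\<close>, division by zero makes both the bound and this choice of \<open>\<delta>\<close> zero.\<close>
    have "real k * (a / (L * m)) * (a - L * m * (a / (L * m)) / 2) \<le> regret k R X"
      using True a m assms(3) by (intro ge) (auto simp: field_simps divide_le_eq_1)
    moreover have "real k * (a / (L * m)) * (a - L * m * (a / (L * m)) / 2)
        = real k * a\<^sup>2 / (2 * m * L)"
      using m by (cases "L = 0") (simp_all add: field_simps power2_eq_square)
    ultimately show ?thesis
      using True by simp
  next
    case False
    then show ?thesis
      using ge[of 1] by simp
  qed
  moreover have "is_arg_max (regret k R) (\<lambda>X. X \<in> review_matrices) X"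
    using X max by (auto simp: is_arg_max_def not_less)
  ultimately show ?thesis
    unfolding a_def m_def by blast
qed

end
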